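(* Let $\Phi=(A;\{E_i\}_{i=0}^d;A^*;\{E^*_i\}_{i=0}^d)$ be a Leonard system in $\mathcal{A}$ with parameter array $(\{\theta_i\}_{i=0}^d;\{\theta^*_i\}_{i=0}^d;\{\varphi_i\}_{i=1}^d;\{\phi_i\}_{i=1}^d)$, and let $\xi_0\in E_0V$, $\xi_d\in E_dV$, $\xi^*_0\in E^*_0V$, $\xi^*_d\in E^*_dV$ be nonzero vectors. Then (i) and (ii) hold. (i) Let $\{X_i\}_{i=0}^d$ denote one of the sequences $\{E_i\}_{i=0}^d$, $\{E_{d-i}\}_{i=0}^d$, $\{\tau_i(A)\}_{i=0}^d$, $\{\tau_{d-i}(A)\}_{i=0}^d$, $\{\eta_i(A)\}_{i=0}^d$, $\{\eta_{d-i}(A)\}_{i=0}^d$. Then for $0\le i\le d$, \begin{align*} \sum_{r=0}^d \frac{X_rE^*_0E_r}{\mathrm{tr}(E_rE^*_0)}\cdot E_i\xi^*_0 &= X_i\xi^*_0,\\ \frac{\tau^*_d(\theta^*_d)}{\phi}\frac{\langle\xi_d,\xi^*_d\rangle}{\langle\xi_d,\xi^*_0\rangle}\sum_{r=0}^d \tau_r(\theta_r)\eta_{d-r}(\theta_r)X_rE^*_dE_r\cdot E_i\xi^*_0 &= X_i\xi^*_d,\\ \sum_{r=0}^d \frac{X_{d-r}E^*_0E_r}{\mathrm{tr}(E_rE^*_0)}\cdot E_{d-i}\xi^*_0 &= X_i\xi^*_0,\\ \frac{\tau^*_d(\theta^*_d)}{\phi}\frac{\langle\xi_d,\xi^*_d\rangle}{\langle\xi_d,\xi^*_0\rangle}\sum_{r=0}^d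 \tau_r(\theta_r)\eta_{d-r}(\theta_r)X_{d-r}E^*_dE_r\cdot E_{d-i}\xi^*_0 &= X_i\xi^*_d. \end{align*} (ii) Let $\{X_i\}_{i=0}^d$ denote one of the sequences $\{E^*_i\}_{i=0}^d$, $\{E^*_{d-i}\}_{i=0}^d$, $\{\tau^*_i(A^* )\}_{i=0}^d$, $\{\tau^*_{d-i}(A^* )\}_{i=0}^d$, $\{\eta^*_i(A^* )\}_{i=0}^d$, $\{\eta^*_{d-i}(A^* )\}_{i=0}^d$. Then for $0\le i\le d$, \begin{align*} \frac{\langle\xi_0,\xi_0\rangle}{\langle\xi_0,\xi^*_0\rangle}\sum_{r=0}^d\frac{X_rE_0E^*_0E_r}{\mathrm{tr}(E_rE^*_0)}\cdot E_i\xi^*_0 &= X_i\xi_0,\\ \frac{\langle\xi_d,\xi_d\rangle}{\langle\xi_d,\xi^*_0\rangle}\sum_{r=0}^d\frac{X_rE_dE^*_0E_r}{\mathrm{tr}(E_rE^*_0)}\cdot E_i\xi^*_0 &= X_i\xi_d,\\ \frac{\langle\xi_0,\xi_0\rangle}{\langle\xi_0,\xi^*_0\rangle}\sum_{r=0}^d\frac{X_{d-r}E_0E^*_0E_r}{\mathrm{tr}(E_rE^*_0)}\cdot E_{d-i}\xi^*_0 &= X_i\xi_0,\\ \frac{\langle\xi_d,\xi_d\rangle}{\langle\xi_d,\xi^*_0\rangle}\sum_{r=0}^d\frac{X_{d-r}E_dE^*_0E_r}{\mathrm{tr}(E_rE^*_0)}\cdot E_{d-i}\xi^*_0 &= X_i\xi_d.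 \end{align*}
   Context: Let $\mathbb{K}$ be a field, $d\ge 0$ an integer, $\mathcal{A}$ a $\mathbb{K}$-algebra isomorphic to the algebra $\mathrm{Mat}_{d+1}(\mathbb{K})$ of all $(d+1)\times(d+1)$ matrices over $\mathbb{K}$, $I$ its identity, and $V$ an irreducible left $\mathcal{A}$-module (so $\dim V=d+1$). For $X\in\mathcal{A}$, $\mathrm{tr}(X)$ is the trace of $X$ (equivalently of its action on $V$). Leonard system. An element of $\mathcal{A}$ is multiplicity-free if it has $d+1$ mutually distinct eigenvalues in $\mathbb{K}$. If $A$ is multiplicity-free with eigenvalues $\theta_0,\dots,\theta_d$, the primitive idempotent of $A$ associated with $\theta_i$ is $E_i=\prod_{0\le j\le d,\,j\ne i}\frac{A-\theta_jI}{\theta_i-\theta_j}$ (the projection onto the one-dimensional $\theta_i$-eigenspace $E_iV$). A Leonard system in $\mathcal{A}$ is a sequence $\Phi=(A;\{E_i\}_{i=0}^d;A^*;\{E^*_i\}_{i=0}^d)$ such that: (i) each of $A,A^*$ is a multiplicity-free element of $\mathcal{A}$ ($A^*$ is just another element; no adjoint is meant); (ii) $\{E_i\}_{i=0}^d$ is an ordering of the primitive idempotents of $A$; (iii) $\{E^*_i\}_{i=0}^d$ is an ordering of the primitive idempotents of $A^*$; (iv) for $0\le i,j\le d$, $E_iA^*E_j=0$ if $|i-j|>1$ and $E_iA^*E_j\ne0$ if $|i-j|=1$; (v) for $0\le i,j\le d$, $E^*_iAE^*_j=0$ if $|i-j|>1$ and $E^*_iAE^*_j\neq0$ if $|i-j|=1$.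 Parameter array. $\theta_i$ (resp. $\theta^*_i$) is the eigenvalue of $A$ (resp. $A^*$) associated with $E_i$ (resp. $E^*_i$). For $0\le i\le d$ define polynomials $\tau_i=(\lambda-\theta_0)(\lambda-\theta_1)\cdots(\lambda-\theta_{i-1})$, $\eta_i=(\lambda-\theta_d)(\lambda-\theta_{d-1})\cdots(\lambda-\theta_{d-i+1})$, $\tau^*_i=(\lambda-\theta^*_0)(\lambda-\theta^*_1)\cdots(\lambda-\theta^*_{i-1})$, $\eta^*_i=(\lambda-\theta^*_d)(\lambda-\theta^*_{d-1})\cdots(\lambda-\theta^*_{d-i+1})$. For $1\le i\le d$ define $\varphi_i=(\theta^*_0-\theta^*_i)\frac{\mathrm{tr}(\tau_i(A)E^*_0)}{\mathrm{tr}(\tau_{i-1}(A)E^*_0)}$ and $\phi_i=(\theta^*_0-\theta^*_i)\frac{\mathrm{tr}(\eta_i(A)E^*_0)}{\mathrm{tr}(\eta_{i-1}(A)E^*_0)}$; the denominators, and all $\varphi_i,\phi_i$, are known to be nonzero. The parameter array of $\Phi$ is $(\{\theta_i\}_{i=0}^d;\{\theta^*_i\}_{i=0}^d;\{\varphi_i\}_{i=1}^d;\{\phi_i\}_{i=1}^d)$. Abbreviate $\varphi=\varphi_1\varphi_2\cdots\varphi_d$ and $\phi=\phi_1\phi_2\cdots\phi_d$. Empty products are $1$. Bilinear form. There is a unique antiautomorphism $\dagger$ of $\mathcal{A}$ ($\mathbb{K}$-linear bijection with $(XY)^\dagger=Y^\dagger X^\dagger$) with $A^\dagger=A$ and $A^{*\dagger}=A^*$.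 $\langle\,,\rangle$ denotes a fixed nonzero bilinear form on $V$ with $\langle Xu,v\rangle=\langle u,X^\dagger v\rangle$ for all $X\in\mathcal{A}$, $u,v\in V$; it exists, is unique up to a nonzero scalar factor, and is nondegenerate and symmetric. All scalars appearing in denominators (traces and inner products) are known to be nonzero. The notation $T\cdot v$ means the element $T\in\mathcal{A}$ (including the scalar prefactor and the whole sum) applied to $v\in V$. *)

theory Defs
  imports "Jordan_Normal_Form.Char_Poly"
begin

section \<open>Algebras isomorphic to a full matrix algebra\<close>

locale field_algebra = vector_space smA
  for smA :: "'k::field \<Rightarrow> 'a::ring_1 \<Rightarrow> 'a" +
  assumes smA_mult_left: "smA c x * y = smA c (x * y)"
    and smA_mult_right: "x * smA c y = smA c (x * y)"

text \<open>\<open>M\<close> is an isomorphism of algebras onto the matrices of size \<open>d + 1\<close>. Traces and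
  eigenvalues of an element \<open>X\<close> are those of the matrix \<open>M X\<close>; they do not depend
  on the choice of \<open>M\<close>, because any two such isomorphisms are conjugate.\<close>

locale full_matrix_algebra = field_algebra smA
  for smA :: "'k::field \<Rightarrow> 'a::ring_1 \<Rightarrow> 'a" +
  fixes d :: nat and M :: "'a \<Rightarrow> 'k mat"
  assumes M_bij: "bij_betw M UNIV (carrier_mat (d + 1) (d + 1))"
    and M_add: "M (X + Y) = M X + M Y"
    and M_smult: "M (smA c X) = c \<cdot>\<^sub>m M X"
    and M_mult: "M (X * Y) = M X * M Y"
    and M_one: "M 1 = 1\<^sub>m (d + 1)"

definition mat_trace :: "'k::comm_ring_1 mat \<Rightarrow> 'k" where
  "mat_trace B = (\<Sum>i<dim_row B. B $$ (i, i))"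

definition tr :: "('a \<Rightarrow> 'k::field mat) \<Rightarrow> 'a \<Rightarrow> 'k" where
  "tr M X = mat_trace (M X)"

definition eigenvalues :: "('a \<Rightarrow> 'k::field mat) \<Rightarrow> 'a \<Rightarrow> 'k set" where
  "eigenvalues M X = {c. eigenvalue (M X) c}"

definition aeval :: "('k::field \<Rightarrow> 'a::ring_1 \<Rightarrow> 'a) \<Rightarrow> 'k poly \<Rightarrow> 'a \<Rightarrow> 'a" where
  "aeval smA p X = (\<Sum>i\<le>degree p. smA (coeff p i) (X ^ i))"


section \<open>Irreducible modules and bilinear forms\<close>

locale algebra_module = field_algebra smA + V: vector_space smV
  for smA :: "'k::field \<Rightarrow> 'a::ring_1 \<Rightarrow> 'a"
    and smV :: "'k \<Rightarrow> 'v::ab_group_add \<Rightarrow> 'v" +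
  fixes act :: "'a \<Rightarrow> 'v \<Rightarrow> 'v"
  assumes act_linear: "Vector_Spaces.linear smV smV (act X)"
    and act_add: "act (X + Y) v = act X v + act Y v"
    and act_smA: "act (smA c X) v = smV c (act X v)"
    and act_mult: "act (X * Y) v = act X (act Y v)"
    and act_one: "act 1 v = v"

locale irreducible_module = algebra_module smA smV act
  for smA :: "'k::field \<Rightarrow> 'a::ring_1 \<Rightarrow> 'a"
    and smV :: "'k \<Rightarrow> 'v::ab_group_add \<Rightarrow> 'v"
    and act :: "'a \<Rightarrow> 'v \<Rightarrow> 'v" +
  assumes nontrivial: "\<exists>v::'v. v \<noteq> 0"
    and irreducible: "V.subspace W \<Longrightarrow> (\<And>X w. w \<in> W \<Longrightarrow> act X w \<in> W) \<Longrightarrow> W = {0} \<or> W = UNIV"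

definition antiautomorphism ::
  "('k::field \<Rightarrow> 'a::ring_1 \<Rightarrow> 'a) \<Rightarrow> ('a \<Rightarrow> 'a) \<Rightarrow> bool" where
  "antiautomorphism smA dag \<longleftrightarrow>
     Vector_Spaces.linear smA smA dag \<and> bij dag \<and> (\<forall>X Y. dag (X * Y) = dag Y * dag X)"

definition bilinear_form ::
  "('k::field \<Rightarrow> 'v::ab_group_add \<Rightarrow> 'v) \<Rightarrow> ('v \<Rightarrow> 'v \<Rightarrow> 'k) \<Rightarrow> bool" where
  "bilinear_form smV form \<longleftrightarrow>
     (\<forall>u. Vector_Spaces.linear smV (*) (\<lambda>v. form u v)) \<and>
     (\<forall>v. Vector_Spaces.linear smV (*) (\<lambda>u. form u v))"


section \<open>Leonard systems\<close>

definition multiplicity_free :: "nat \<Rightarrow> ('a \<Rightarrow> 'k::field mat) \<Rightarrow> 'a \<Rightarrow> bool" where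
  "multiplicity_free d M X \<longleftrightarrow> card (eigenvalues M X) = d + 1"

text \<open>The product is formed in the commutative ring of polynomials and then evaluated at
  \<open>X\<close>. For multiplicity-free \<open>X\<close> the index set is finite.\<close>

definition primitive_idempotent ::
  "('k::field \<Rightarrow> 'a::ring_1 \<Rightarrow> 'a) \<Rightarrow> ('a \<Rightarrow> 'k mat) \<Rightarrow> 'a \<Rightarrow> 'k \<Rightarrow> 'a" where
  "primitive_idempotent smA M X c =
     aeval smA (\<Prod>e\<in>eigenvalues M X - {c}. Polynomial.smult (1 / (c - e)) [:- e, 1:]) X"

definition leonard_system ::
  "('k::field \<Rightarrow> 'a::ring_1 \<Rightarrow> 'a) \<Rightarrow> nat \<Rightarrow> ('a \<Rightarrow> 'k mat) \<Rightarrow>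
   'a \<Rightarrow> (nat \<Rightarrow> 'a) \<Rightarrow> 'a \<Rightarrow> (nat \<Rightarrow> 'a) \<Rightarrow> bool" where
  "leonard_system smA d M A E As Es \<longleftrightarrow>
     multiplicity_free d M A \<and> multiplicity_free d M As \<and>
     bij_betw E {0..d} (primitive_idempotent smA M A ` eigenvalues M A) \<and>
     bij_betw Es {0..d} (primitive_idempotent smA M As ` eigenvalues M As) \<and>
     (\<forall>i\<le>d. \<forall>j\<le>d. (\<bar>int i - int j\<bar> > 1 \<longrightarrow> E i * As * E j = 0) \<and>
                   (\<bar>int i - int j\<bar> = 1 \<longrightarrow> E i * As * E j \<noteq> 0)) \<and>
     (\<forall>i\<le>d. \<forall>j\<le>d. (\<bar>int i - int j\<bar> > 1 \<longrightarrow> Es i * A * Es j = 0) \<and>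
                   (\<bar>int i - int j\<bar> = 1 \<longrightarrow> Es i * A * Es j \<noteq> 0))"


section \<open>Parameter arrays\<close>

text \<open>With the dual eigenvalue sequence in place of \<open>\<theta>\<close>, these are the polynomials
  $\tau^*_i$ and $\eta^*_i$.\<close>

definition tau :: "(nat \<Rightarrow> 'k::field) \<Rightarrow> nat \<Rightarrow> 'k poly" where
  "tau \<theta> i = (\<Prod>h<i. [:- \<theta> h, 1:])"

definition eta :: "nat \<Rightarrow> (nat \<Rightarrow> 'k::field) \<Rightarrow> nat \<Rightarrow> 'k poly" where
  "eta d \<theta> i = (\<Prod>h<i. [:- \<theta> (d - h), 1:])"

definition parameter_array ::
  "('k::field \<Rightarrow> 'a::ring_1 \<Rightarrow> 'a) \<Rightarrow> nat \<Rightarrow> ('a \<Rightarrow> 'k mat) \<Rightarrow>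
   'a \<Rightarrow> (nat \<Rightarrow> 'a) \<Rightarrow> 'a \<Rightarrow> (nat \<Rightarrow> 'a) \<Rightarrow>
   (nat \<Rightarrow> 'k) \<Rightarrow> (nat \<Rightarrow> 'k) \<Rightarrow> (nat \<Rightarrow> 'k) \<Rightarrow> (nat \<Rightarrow> 'k) \<Rightarrow> bool" where
  "parameter_array smA d M A E As Es \<theta> \<theta>s varphi phi \<longleftrightarrow>
     (\<forall>i\<le>d. \<theta> i \<in> eigenvalues M A \<and> E i = primitive_idempotent smA M A (\<theta> i)) \<and>
     (\<forall>i\<le>d. \<theta>s i \<in> eigenvalues M As \<and> Es i = primitive_idempotent smA M As (\<theta>s i)) \<and>
     (\<forall>i\<in>{1..d}. varphi i = (\<theta>s 0 - \<theta>s i) *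
        (tr M (aeval smA (tau \<theta> i) A * Es 0) / tr M (aeval smA (tau \<theta> (i - 1)) A * Es 0))) \<and>
     (\<forall>i\<in>{1..d}. phi i = (\<theta>s 0 - \<theta>s i) *
        (tr M (aeval smA (eta d \<theta> i) A * Es 0) / tr M (aeval smA (eta d \<theta> (i - 1)) A * Es 0)))"

end

theory Submission
  imports Defs
begin

text \<open>
  Because the \<open>E r\<close> are orthogonal idempotents, applying \<open>\<Sum>r. g r Z\<^sub>r E\<^sub>r\<close> to
  \<open>E\<^sub>i \<xi>*\<^sub>0\<close> leaves \<open>g i Z\<^sub>i E\<^sub>i \<xi>*\<^sub>0\<close> only (\<open>sum_mult_idem_act\<close>). Every identity
  therefore reduces to one vector identity in which the sequence \<open>X\<close> occurs as an
  arbitrary left factor, so that one argument covers all six candidates; the versions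
  with \<open>d - r\<close> and \<open>d - i\<close> are the same identities for the reversed sequence.

  The reduced identities concern products of the rank one idempotents \<open>E\<^sub>i\<close> and \<open>E*\<^sub>j\<close>. A
  rank one idempotent satisfies \<open>F Y F = tr (Y F) F\<close>. Hence
  \<open>E*\<^sub>0 E\<^sub>i \<xi>*\<^sub>0 = tr (E\<^sub>i E*\<^sub>0) \<xi>*\<^sub>0\<close>, which is the identity with \<open>E*\<^sub>0\<close>. The invariant form
  turns \<open>E\<^sub>n\<close> into the orthogonal projection onto the line of \<open>\<xi>\<^sub>n\<close>, which gives the
  identities of the second part.

  The identity with \<open>E*\<^sub>d\<close> needs the scalar \<open>\<phi>\<close>. Its source is a triangular principle
  (\<open>raise_aeval\<close>): \<open>A\<close> raises the index of the \<open>E*\<close>-components by at most one, so for a monic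
  polynomial \<open>p\<close> of degree \<open>d\<close> the vector \<open>E*\<^sub>d p(A) \<xi>*\<^sub>0\<close> does not depend on \<open>p\<close>. Choosing
  \<open>p\<close> to vanish at all eigenvalues but \<open>\<theta> i\<close> shows that the vectors \<open>E*\<^sub>d E\<^sub>i \<xi>*\<^sub>0\<close> are, up to
  explicit factors, one common vector \<open>K = E*\<^sub>d \<eta>\<^sub>d(A) \<xi>*\<^sub>0\<close> (\<open>last_component\<close>). The
  multiple of \<open>\<xi>*\<^sub>d\<close> that \<open>K\<close> represents is found by projecting to the line of \<open>\<xi>\<^sub>d\<close>: the
  same principle with the roles of \<open>A\<close> and \<open>A*\<close> exchanged allows one to replace
  \<open>\<tau>*\<^sub>d(A*)\<close>, a multiple of \<open>E*\<^sub>d\<close>, by \<open>\<eta>*\<^sub>d(A*)\<close>, a multiple of \<open>E*\<^sub>0\<close>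
  (\<open>last_component_projection\<close>), and the resulting scalar is the product of the \<open>\<phi>\<^sub>i\<close>, which
  telescopes (\<open>prod_phi\<close>).

  The triangular principle also supplies the nonvanishing of the components \<open>E\<^sub>r \<xi>*\<^sub>0\<close> and of
  the traces that occur in denominators.
\<close>


section \<open>Polynomials in an element of an algebra\<close>

context field_algebra
begin

lemma power_mult_eigen:
  assumes "X * Y = smA c Y"
  shows "X ^ n * Y = smA (c ^ n) Y"
proof (induction n)
  case (Suc n)
  have "X ^ Suc n * Y = X ^ n * (X * Y)"
    by (metis power_Suc2 mult.assoc)
  also have "\<dots> = smA (c ^ Suc n) Y"
    using Suc by (simp add: assms smA_mult_right mult.commute)
  finally show ?case .
qed simp

lemma aeval_mult_eigen:
  assumes "X * Y = smA c Y"
  shows "aeval smA p X * Y = smA (poly p c) Y"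
proof -
  have "aeval smA p X * Y = (\<Sum>i\<le>degree p. smA (coeff p i * c ^ i) Y)"
    by (simp add: aeval_def sum_distrib_right smA_mult_left power_mult_eigen[OF assms])
  also have "\<dots> = smA (poly p c) Y"
    by (simp add: poly_altdef scale_sum_left)
  finally show ?thesis .
qed

text \<open>Powers of \<open>X\<close> commute, so reversing products leaves them fixed; the constant term
  needs \<open>dag 1 = 1\<close>, which follows from surjectivity.\<close>

lemma antiautomorphism_aeval:
  assumes dag: "antiautomorphism smA dag" and X: "dag X = X"
  shows "dag (aeval smA p X) = aeval smA p X"
proof -
  interpret dag: Vector_Spaces.linear smA smA dag
    using dag by (simp add: antiautomorphism_def)
  have anti: "dag (Y * Z) = dag Z * dag Y" for Y Z
    using dag by (simp add: antiautomorphism_def)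
  have "surj dag"
    using dag by (simp add: antiautomorphism_def bij_def)
  then obtain Y where "dag Y = 1"
    by (metis surjD)
  then have one: "dag 1 = 1"
    using anti[of Y 1] by simp
  have "dag (X ^ n) = X ^ n" for n
    by (induction n) (simp_all add: one anti X power_commutes)
  then show ?thesis
    by (simp add: aeval_def dag.sum dag.scale)
qed

end


section \<open>Primitive idempotents in a full matrix algebra\<close>

context full_matrix_algebra
begin

lemma M_carrier [simp]: "M X \<in> carrier_mat (d + 1) (d + 1)"
  using M_bij by (auto simp: bij_betw_def)

lemma M_dims [simp]: "dim_row (M X) = d + 1" "dim_col (M X) = d + 1"
  using M_carrier[of X] by auto

lemma M_eqI:
  assumes "\<And>k l. k \<le> d \<Longrightarrow> l \<le> d \<Longrightarrow> M X $$ (k, l) = M Y $$ (k, l)"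
  shows "X = Y"
proof -
  have "M X = M Y"
    by (rule eq_matI) (use assms in \<open>auto simp: less_Suc_eq_le\<close>)
  then show ?thesis
    using M_bij by (auto simp: bij_betw_def dest: injD)
qed

lemma M_surj:
  obtains X where "\<And>k l. k \<le> d \<Longrightarrow> l \<le> d \<Longrightarrow> M X $$ (k, l) = f k l"
proof -
  have "mat (d + 1) (d + 1) (\<lambda>(k, l). f k l) \<in> range M"
    using M_bij by (simp add: bij_betw_def)
  then obtain X where "M X = mat (d + 1) (d + 1) (\<lambda>(k, l). f k l)"
    by (metis imageE)
  then show ?thesis
    by (intro that[of X]) simp
qed

lemma M_mult_entry:
  assumes "k \<le> d" "l \<le> d"
  shows "M (X * Y) $$ (k, l) = (\<Sum>n\<le>d. M X $$ (k, n) * M Y $$ (n, l))"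
  using assms by (simp add: M_mult scalar_prod_def atLeast0LessThan lessThan_Suc_atMost)

lemma M_add_entry:
  assumes "k \<le> d" "l \<le> d"
  shows "M (X + Y) $$ (k, l) = M X $$ (k, l) + M Y $$ (k, l)"
  using assms by (simp add: M_add)

lemma M_smA_entry:
  assumes "k \<le> d" "l \<le> d"
  shows "M (smA c X) $$ (k, l) = c * M X $$ (k, l)"
  using assms by (simp add: M_smult)

lemma M_zero_entry:
  assumes "k \<le> d" "l \<le> d"
  shows "M 0 $$ (k, l) = 0"
  using M_smA_entry[OF assms, of 0 0] by simp

lemma M_sum_entry:
  assumes "k \<le> d" "l \<le> d"
  shows "M (sum f S) $$ (k, l) = (\<Sum>s\<in>S. M (f s) $$ (k, l))"
  by (induction S rule: infinite_finite_induct) (simp_all add: M_zero_entry M_add_entry assms)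

lemma tr_eq: "tr M X = (\<Sum>k\<le>d. M X $$ (k, k))"
  by (simp add: tr_def mat_trace_def lessThan_Suc_atMost)

text \<open>With \<open>F = a b\<^sup>T\<close> one has \<open>F Y F = a (b\<^sup>T Y a) b\<^sup>T\<close>, and the scalar in the middle is the
  trace of \<open>Y a b\<^sup>T\<close>.\<close>

lemma rank_one_sandwich:
  assumes F: "\<And>k l. k \<le> d \<Longrightarrow> l \<le> d \<Longrightarrow> M F $$ (k, l) = a k * b l"
  shows "F * Y * F = smA (tr M (Y * F)) F"
proof (rule M_eqI)
  fix k l assume kl: "k \<le> d" "l \<le> d"
  have "M (F * Y * F) $$ (k, l) = M (F * (Y * F)) $$ (k, l)"
    by (simp add: mult.assoc)
  also have "\<dots> = (\<Sum>n\<le>d. a k * b n * (\<Sum>m\<le>d. M Y $$ (n, m) * (a m * b l)))"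
    using kl by (simp add: M_mult_entry F)
  also have "\<dots> = (\<Sum>n\<le>d. \<Sum>m\<le>d. M Y $$ (n, m) * (a m * b n)) * (a k * b l)"
    by (simp add: sum_distrib_left sum_distrib_right mult_ac)
  also have "(\<Sum>n\<le>d. \<Sum>m\<le>d. M Y $$ (n, m) * (a m * b n)) = tr M (Y * F)"
    by (simp add: tr_eq M_mult_entry F)
  finally show "M (F * Y * F) $$ (k, l) = M (smA (tr M (Y * F)) F) $$ (k, l)"
    using kl by (simp add: M_smA_entry F)
qed

lemma eigenvalue_elem:
  assumes "c \<in> eigenvalues M X"
  obtains v where "\<exists>k\<le>d. v k \<noteq> 0"
    and "\<And>k. k \<le> d \<Longrightarrow> (\<Sum>n\<le>d. M X $$ (k, n) * v n) = c * v k"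
proof -
  from assms obtain v where v: "v \<in> carrier_vec (d + 1)" "v \<noteq> 0\<^sub>v (d + 1)" "M X *\<^sub>v v = c \<cdot>\<^sub>v v"
    by (auto simp: eigenvalues_def eigenvalue_def eigenvector_def)
  show ?thesis
  proof (rule that[of "\<lambda>k. v $ k"])
    show "\<exists>k\<le>d. v $ k \<noteq> 0"
      using v(1,2) by (metis Suc_eq_plus1 carrier_vecD eq_vecI index_zero_vec less_Suc_eq_le)
    fix k assume "k \<le> d"
    have "(M X *\<^sub>v v) $ k = (\<Sum>n\<le>d. M X $$ (k, n) * v $ n)"
      using \<open>k \<le> d\<close> v(1)
      by (simp add: scalar_prod_def atLeast0LessThan lessThan_Suc_atMost)
    then show "(\<Sum>n\<le>d. M X $$ (k, n) * v $ n) = c * v $ k"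
      using v \<open>k \<le> d\<close> by simp
  qed
qed

text \<open>The polynomial that defines the primitive idempotent is the Lagrange polynomial of \<open>c\<close>
  on the set of eigenvalues.\<close>

lemma primitive_idempotent_mult_eigen:
  assumes fin: "finite (eigenvalues M X)"
    and e: "e \<in> eigenvalues M X" and Y: "X * Y = smA e Y"
  shows "primitive_idempotent smA M X c * Y = (if e = c then Y else 0)"
proof -
  define p where "p = (\<Prod>e\<in>eigenvalues M X - {c}. Polynomial.smult (1 / (c - e)) [:- e, 1:])"
  have "poly p e = (if e = c then 1 else 0)"
    using fin e by (cases "e = c") (auto simp: p_def poly_prod diff_divide_distrib[symmetric] intro!: prod.neutral)
  then show ?thesis
    using aeval_mult_eigen[OF Y, of p] by (simp add: primitive_idempotent_def p_def)
qed

lemma invertible_of_trivial_kernel: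
  assumes "\<And>w. \<forall>k\<le>d. (\<Sum>n\<le>d. M P $$ (k, n) * w n) = 0 \<Longrightarrow> \<forall>n\<le>d. w n = 0"
  obtains Q where "P * Q = 1"
proof -
  have "det (M P) \<noteq> 0"
  proof
    assume "det (M P) = 0"
    then obtain v where v: "v \<in> carrier_vec (d + 1)" "v \<noteq> 0\<^sub>v (d + 1)" "M P *\<^sub>v v = 0\<^sub>v (d + 1)"
      using det_0_iff_vec_prod_zero_field[OF M_carrier] by blast
    have "\<forall>k\<le>d. (\<Sum>n\<le>d. M P $$ (k, n) * v $ n) = 0"
    proof (intro allI impI)
      fix k assume "k \<le> d"
      have "(M P *\<^sub>v v) $ k = (\<Sum>n\<le>d. M P $$ (k, n) * v $ n)"
        using \<open>k \<le> d\<close> v(1)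
        by (simp add: scalar_prod_def atLeast0LessThan lessThan_Suc_atMost)
      then show "(\<Sum>n\<le>d. M P $$ (k, n) * v $ n) = 0"
        using v(3) \<open>k \<le> d\<close> by simp
    qed
    from assms[OF this] have "v = 0\<^sub>v (d + 1)"
      using v(1) by (intro eq_vecI) (auto simp: less_Suc_eq_le)
    then show False using v(2) by contradiction
  qed
  then have "M P \<in> Units (ring_mat TYPE('k) (d + 1) ())"
    by (rule det_non_zero_imp_unit[OF M_carrier])
  then obtain B where B: "B \<in> carrier_mat (d + 1) (d + 1)" "M P * B = 1\<^sub>m (d + 1)"
    by (auto simp: Units_def ring_mat_def)
  obtain Q where "M Q = B"
    using B(1) M_bij by (metis bij_betw_def imageE)
  then have "M (P * Q) = M 1"
    using B(2) by (simp add: M_mult M_one)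
  then have "P * Q = 1"
    using M_bij by (auto simp: bij_betw_def dest: injD)
  then show ?thesis by (rule that)
qed

end

text \<open>These are the properties of the primitive idempotents of a multiplicity-free element
  through which they enter all later arguments.\<close>

locale primitive_resolution = full_matrix_algebra smA d M
  for smA :: "'k::field \<Rightarrow> 'a::ring_1 \<Rightarrow> 'a" and d :: nat and M :: "'a \<Rightarrow> 'k mat" +
  fixes X :: 'a and \<theta> :: "nat \<Rightarrow> 'k" and F :: "nat \<Rightarrow> 'a"
  assumes idem_mult: "i \<le> d \<Longrightarrow> j \<le> d \<Longrightarrow> F i * F j = (if i = j then F i else 0)"
    and idem_sum: "(\<Sum>i\<le>d. F i) = 1"
    and mult_idem: "i \<le> d \<Longrightarrow> X * F i = smA (\<theta> i) (F i)"
    and idem_sandwich: "i \<le> d \<Longrightarrow> F i * Y * F i = smA (tr M (Y * F i)) (F i)"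
    and eigenvalue_inj: "inj_on \<theta> {..d}"

text \<open>Eigenvectors for distinct eigenvalues are independent, so the matrix \<open>P\<close> with these
  columns has an inverse \<open>Q\<close>. Multiplication by \<open>F i\<close> keeps the \<open>i\<close>-th column of \<open>P\<close> and
  deletes the others, so \<open>F i\<close> is the product of the \<open>i\<close>-th column of \<open>P\<close> and the \<open>i\<close>-th
  row of \<open>Q\<close>.\<close>

lemma (in full_matrix_algebra) primitive_resolution_of_multiplicity_free:
  assumes mf: "multiplicity_free d M X"
    and ev: "\<And>i. i \<le> d \<Longrightarrow> \<theta> i \<in> eigenvalues M X"
    and inj: "inj_on \<theta> {..d}"
    and F: "\<And>i. i \<le> d \<Longrightarrow> F i = primitive_idempotent smA M X (\<theta> i)"
  shows "primitive_resolution smA d M X \<theta> F"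
proof -
  have fin: "finite (eigenvalues M X)"
    using mf unfolding multiplicity_free_def by (metis Suc_eq_plus1 card.infinite nat.distinct(1))
  have "\<exists>v. (\<exists>k\<le>d. v k \<noteq> 0) \<and> (\<forall>k\<le>d. (\<Sum>n\<le>d. M X $$ (k, n) * v n) = \<theta> i * v k)" if "i \<le> d" for i
    using eigenvalue_elem[OF ev[OF that]] by metis
  then obtain v where v_nz: "\<And>i. i \<le> d \<Longrightarrow> \<exists>k\<le>d. v i k \<noteq> 0"
    and v_eig: "\<And>i k. i \<le> d \<Longrightarrow> k \<le> d \<Longrightarrow> (\<Sum>n\<le>d. M X $$ (k, n) * v i n) = \<theta> i * v i k"
    by metis
  \<comment> \<open>Keeping each eigenvector as a column of a square matrix, with zeros elsewhere, makes
    the eigenvector equation an equation in the algebra.\<close>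
  have "\<exists>Y. \<forall>k\<le>d. \<forall>l\<le>d. M Y $$ (k, l) = (if l = i then v i k else 0)" for i
    by (rule M_surj[of "\<lambda>k l. if l = i then v i k else 0"]) blast
  then obtain Y where Y: "\<And>i k l. k \<le> d \<Longrightarrow> l \<le> d \<Longrightarrow> M (Y i) $$ (k, l) = (if l = i then v i k else 0)"
    by metis
  have XY: "X * Y i = smA (\<theta> i) (Y i)" if "i \<le> d" for i
  proof (rule M_eqI)
    fix k l assume "k \<le> d" "l \<le> d"
    then show "M (X * Y i) $$ (k, l) = M (smA (\<theta> i) (Y i)) $$ (k, l)"
      using v_eig[OF that] by (cases "l = i") (simp_all add: M_mult_entry M_smA_entry Y)
  qed
  have FY: "F j * Y i = (if i = j then Y i else 0)" if "i \<le> d" "j \<le> d" for i j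
    using primitive_idempotent_mult_eigen[OF fin ev[OF that(1)] XY[OF that(1)]] inj that
    by (auto simp: F inj_on_def)
  define P where "P = (\<Sum>i\<le>d. Y i)"
  have FP: "F j * P = Y j" if "j \<le> d" for j
    using that by (simp add: P_def sum_distrib_left FY)
  obtain Q where PQ: "P * Q = 1"
  proof (rule invertible_of_trivial_kernel)
    fix w assume w: "\<forall>k\<le>d. (\<Sum>n\<le>d. M P $$ (k, n) * w n) = 0"
    show "\<forall>j\<le>d. w j = 0"
    proof (intro allI impI)
      fix j assume j: "j \<le> d"
      obtain a where a: "a \<le> d" "v j a \<noteq> 0"
        using v_nz[OF j] by blast
      have "0 = (\<Sum>k\<le>d. M (F j) $$ (a, k) * (\<Sum>n\<le>d. M P $$ (k, n) * w n))"
        using w by simp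
      also have "\<dots> = (\<Sum>k\<le>d. \<Sum>n\<le>d. M (F j) $$ (a, k) * M P $$ (k, n) * w n)"
        by (simp add: sum_distrib_left mult.assoc)
      also have "\<dots> = (\<Sum>n\<le>d. \<Sum>k\<le>d. M (F j) $$ (a, k) * M P $$ (k, n) * w n)"
        by (rule sum.swap)
      also have "\<dots> = (\<Sum>n\<le>d. M (F j * P) $$ (a, n) * w n)"
        using a by (simp add: M_mult_entry sum_distrib_right)
      also have "\<dots> = (\<Sum>n\<le>d. if n = j then v j a * w n else 0)"
        by (rule sum.cong) (use a j in \<open>auto simp: FP Y\<close>)
      also have "\<dots> = v j a * w j"
        using j by simp
      finally show "w j = 0" using a by simp
    qed
  qed
  have F_eq: "F i = Y i * Q" if "i \<le> d" for i
    using FP[OF that] PQ by (metis mult.assoc mult.right_neutral)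
  show ?thesis
  proof
    fix i j assume ij: "i \<le> d" "j \<le> d"
    have "F i * F j = F i * Y j * Q"
      using ij by (simp add: F_eq[of j] mult.assoc)
    then show "F i * F j = (if i = j then F i else 0)"
      using ij by (auto simp: FY F_eq[symmetric])
  next
    show "(\<Sum>i\<le>d. F i) = 1"
      using PQ by (simp add: F_eq P_def sum_distrib_right)
  next
    fix i assume i: "i \<le> d"
    show "X * F i = smA (\<theta> i) (F i)"
      using XY[OF i] by (simp add: F_eq[OF i] smA_mult_left flip: mult.assoc)
    show "F i * Z * F i = smA (tr M (Z * F i)) (F i)" for Z
    proof (rule rank_one_sandwich[where a = "v i" and b = "\<lambda>l. M Q $$ (i, l)"])
      fix k l assume "k \<le> d" "l \<le> d"
      then have "M (F i) $$ (k, l) = (\<Sum>n\<le>d. if n = i then v i k * M Q $$ (n, l) else 0)"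
        by (simp add: F_eq[OF i] M_mult_entry Y if_distrib if_distribR cong: if_cong)
      then show "M (F i) $$ (k, l) = v i k * M Q $$ (i, l)"
        using i by simp
    qed
  qed (rule inj)
qed


section \<open>The irreducible module\<close>

context algebra_module
begin

sublocale act: Vector_Spaces.linear smV smV "act X" for X
  by (rule act_linear)

lemma act_zero_left [simp]: "act 0 v = 0"
  using act_smA[of 0 0 v] by simp

lemma act_sum_left: "act (sum f S) v = (\<Sum>s\<in>S. act (f s) v)"
  by (induction S rule: infinite_finite_induct) (simp_all add: act_add)

end

locale matrix_module = full_matrix_algebra smA d M + irreducible_module smA smV act
  for smA :: "'k::field \<Rightarrow> 'a::ring_1 \<Rightarrow> 'a" and d :: nat and M :: "'a \<Rightarrow> 'k mat"
    and smV :: "'k \<Rightarrow> 'v::ab_group_add \<Rightarrow> 'v" and act :: "'a \<Rightarrow> 'v \<Rightarrow> 'v"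
begin

text \<open>The submodule generated by a nonzero vector is everything.\<close>

lemma cyclic:
  assumes "u \<noteq> 0"
  obtains Y where "v = act Y u"
proof -
  have sub: "V.subspace (range (\<lambda>Y. act Y u))"
  proof (rule V.subspaceI)
    show "0 \<in> range (\<lambda>Y. act Y u)"
      by (metis act_zero_left rangeI)
  qed (auto simp flip: act_add act_smA)
  have "range (\<lambda>Y. act Y u) = {0} \<or> range (\<lambda>Y. act Y u) = UNIV"
    by (rule irreducible[OF sub]) (auto simp flip: act_mult)
  moreover have "u \<in> range (\<lambda>Y. act Y u)"
    by (metis act_one rangeI)
  ultimately show ?thesis
    using assms that by (metis UNIV_I imageE singletonD)
qed

text \<open>A full matrix algebra is simple: with matrix units \<open>U\<close>, a nonzero entry \<open>x\<close> of \<open>X\<close> at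
  \<open>(p, q)\<close> gives \<open>U\<^sub>a\<^sub>p X U\<^sub>q\<^sub>a = x U\<^sub>a\<^sub>a\<close>. If \<open>X\<close> acts as zero then so do all \<open>U\<^sub>a\<^sub>a\<close> and
  their sum, the identity.\<close>

lemma faithful:
  assumes X: "\<And>v. act X v = 0"
  shows "X = 0"
proof (rule ccontr)
  assume "X \<noteq> 0"
  then obtain p q where pq: "p \<le> d" "q \<le> d" "M X $$ (p, q) \<noteq> 0"
    using M_eqI[of X 0] by (auto simp: M_zero_entry)
  have "\<exists>U. \<forall>k\<le>d. \<forall>l\<le>d. M U $$ (k, l) = (if k = a \<and> l = b then 1 else 0)" for a b
    by (rule M_surj[of "\<lambda>k l. if k = a \<and> l = b then 1 else 0"]) blast
  then obtain U where U: "\<And>a b k l. k \<le> d \<Longrightarrow> l \<le> d \<Longrightarrow>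
      M (U a b) $$ (k, l) = (if k = a \<and> l = b then 1 else 0)"
    by metis
  have left: "M (U a p * Z) $$ (k, l) = (if k = a then M Z $$ (p, l) else 0)"
    if "k \<le> d" "l \<le> d" for a Z k l
  proof -
    have "M (U a p * Z) $$ (k, l) = (\<Sum>n\<le>d. if n = p then (if k = a then M Z $$ (n, l) else 0) else 0)"
      unfolding M_mult_entry[OF that] by (rule sum.cong) (use that pq in \<open>auto simp: U\<close>)
    then show ?thesis using pq by simp
  qed
  have right: "M (Z * U q a) $$ (k, l) = (if l = a then M Z $$ (k, q) else 0)"
    if "k \<le> d" "l \<le> d" for a Z k l
  proof -
    have "M (Z * U q a) $$ (k, l) = (\<Sum>n\<le>d. if n = q then (if l = a then M Z $$ (k, n) else 0) else 0)"
      unfolding M_mult_entry[OF that] by (rule sum.cong) (use that pq in \<open>auto simp: U\<close>)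
    then show ?thesis using pq by simp
  qed
  have unit: "U a p * X * U q a = smA (M X $$ (p, q)) (U a a)" for a
    by (rule M_eqI) (simp add: left right M_smA_entry U pq)
  have one: "(\<Sum>a\<le>d. U a a) = 1"
  proof (rule M_eqI)
    fix k l assume kl: "k \<le> d" "l \<le> d"
    have "M (\<Sum>a\<le>d. U a a) $$ (k, l) = (\<Sum>a\<le>d. if a = k then (if k = l then 1 else 0) else 0)"
      unfolding M_sum_entry[OF kl] by (rule sum.cong) (use kl in \<open>auto simp: U\<close>)
    then show "M (\<Sum>a\<le>d. U a a) $$ (k, l) = M 1 $$ (k, l)"
      using kl by (simp add: M_one)
  qed
  have "act (U a a) v = 0" for a v
  proof -
    have "smV (M X $$ (p, q)) (act (U a a) v) = act (U a p * X * U q a) v"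
      by (simp add: unit act_smA)
    also have "\<dots> = 0"
      by (simp add: act_mult X)
    finally show ?thesis
      using pq(3) by simp
  qed
  then have "act 1 v = 0" for v
    by (simp add: act_sum_left flip: one)
  then show False
    using nontrivial by (simp add: act_one)
qed

end

locale resolved_module = primitive_resolution smA d M X \<theta> F + matrix_module smA d M smV act
  for smA :: "'k::field \<Rightarrow> 'a::ring_1 \<Rightarrow> 'a" and d :: nat and M :: "'a \<Rightarrow> 'k mat"
    and smV :: "'k \<Rightarrow> 'v::ab_group_add \<Rightarrow> 'v" and act :: "'a \<Rightarrow> 'v \<Rightarrow> 'v"
    and X :: 'a and \<theta> :: "nat \<Rightarrow> 'k" and F :: "nat \<Rightarrow> 'a"
begin

lemma act_idem_idem:
  "i \<le> d \<Longrightarrow> j \<le> d \<Longrightarrow> act (F i) (act (F j) v) = (if i = j then act (F i) v else 0)"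
  by (simp add: idem_mult flip: act_mult)

lemma act_other_idem:
  assumes "i \<le> d" "act (F i) u = u" "j \<le> d" "j \<noteq> i"
  shows "act (F j) u = 0"
  using act_idem_idem[OF assms(3,1), of u] assms by simp

lemma idem_decomp: "v = (\<Sum>j\<le>d. act (F j) v)"
  by (simp add: idem_sum act_one flip: act_sum_left)

lemma act_aeval: "act (aeval smA p X) v = (\<Sum>j\<le>d. smV (poly p (\<theta> j)) (act (F j) v))"
proof -
  have "act (aeval smA p X) v = (\<Sum>j\<le>d. act (aeval smA p X) (act (F j) v))"
    by (subst idem_decomp[of v]) (rule act.sum)
  also have "\<dots> = (\<Sum>j\<le>d. smV (poly p (\<theta> j)) (act (F j) v))"
    by (rule sum.cong)
      (simp_all add: aeval_mult_eigen[OF mult_idem] act_smA flip: act_mult)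
  finally show ?thesis .
qed

lemma act_idem_aeval:
  assumes "i \<le> d"
  shows "act (F i) (act (aeval smA p X) v) = smV (poly p (\<theta> i)) (act (F i) v)"
proof -
  have "act (F i) (act (aeval smA p X) v) =
      (\<Sum>j\<le>d. if i = j then smV (poly p (\<theta> i)) (act (F i) v) else 0)"
    unfolding act_aeval act.sum
    by (rule sum.cong) (use assms in \<open>auto simp: act.scale act_idem_idem\<close>)
  then show ?thesis using assms by simp
qed

lemma act_aeval_single:
  assumes "i \<le> d" "\<And>j. j \<le> d \<Longrightarrow> j \<noteq> i \<Longrightarrow> smV (poly p (\<theta> j)) (act (F j) v) = 0"
  shows "act (aeval smA p X) v = smV (poly p (\<theta> i)) (act (F i) v)"
proof -
  have "act (aeval smA p X) v = (\<Sum>j\<le>d. if j = i then smV (poly p (\<theta> i)) (act (F i) v) else 0)"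
    unfolding act_aeval by (rule sum.cong) (use assms in auto)
  then show ?thesis using assms(1) by simp
qed

lemma act_sandwich:
  assumes "i \<le> d" "act (F i) u = u"
  shows "act (F i) (act Y u) = smV (tr M (Y * F i)) u"
proof -
  have "act (F i) (act Y u) = act (F i * Y * F i) u"
    using assms(2) by (simp add: act_mult)
  then show ?thesis
    using assms by (simp add: idem_sandwich act_smA)
qed

text \<open>The images of the \<open>F i\<close> are lines: any \<open>v\<close> is \<open>Y u\<close> for some \<open>Y\<close>, and
  \<open>F i Y F i\<close> is a multiple of \<open>F i\<close>.\<close>

lemma eigenspace_line:
  assumes i: "i \<le> d" and u: "act (F i) u = u" "u \<noteq> 0"
  obtains c where "act (F i) v = smV c u"
proof -
  obtain Y where "v = act Y u"
    using cyclic[OF u(2)] .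
  then show ?thesis
    using that act_sandwich[OF i u(1)] by metis
qed

lemma range_idem: "i \<le> d \<Longrightarrow> u \<in> range (act (F i)) \<Longrightarrow> act (F i) u = u"
  by (auto simp: act_idem_idem)

lemma sum_mult_idem_act:
  assumes "i \<le> d"
  shows "act (\<Sum>r\<le>d. smA (g r) (Z r * F r)) (act (F i) v) = smV (g i) (act (Z i) (act (F i) v))"
proof -
  have "act (\<Sum>r\<le>d. smA (g r) (Z r * F r)) (act (F i) v) =
      (\<Sum>r\<le>d. if r = i then smV (g i) (act (Z i) (act (F i) v)) else 0)"
    unfolding act_sum_left
    by (rule sum.cong) (use assms in \<open>auto simp: act_smA act_mult act_idem_idem\<close>)
  then show ?thesis using assms by simp
qed

end


section \<open>Raising operators\<close>

text \<open>With respect to the decomposition of the module by the \<open>F i\<close>, the matrix of \<open>T\<close> vanishes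
  below the subdiagonal and is nonzero on it. In a Leonard system both \<open>A*\<close> relative to
  the \<open>E i\<close> and \<open>A\<close> relative to the \<open>E*\<^sub>i\<close> are of this form, so that each lemma below can
  be used in two ways.\<close>

locale hessenberg_operator = resolved_module smA d M smV act X \<theta> F
  for smA :: "'k::field \<Rightarrow> 'a::ring_1 \<Rightarrow> 'a" and d :: nat and M :: "'a \<Rightarrow> 'k mat"
    and smV :: "'k \<Rightarrow> 'v::ab_group_add \<Rightarrow> 'v" and act :: "'a \<Rightarrow> 'v \<Rightarrow> 'v"
    and X :: 'a and \<theta> :: "nat \<Rightarrow> 'k" and F :: "nat \<Rightarrow> 'a" +
  fixes T :: 'a
  assumes raise_zero: "l \<le> d \<Longrightarrow> Suc j < l \<Longrightarrow> F l * T * F j = 0"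
    and raise_nonzero: "Suc j \<le> d \<Longrightarrow> F (Suc j) * T * F j \<noteq> 0"
begin

text \<open>Each application of \<open>T\<close> raises the highest index of a nonzero component by exactly
  one: the new top component is the image of the old one under \<open>F\<^sub>j\<^sub>+\<^sub>1 T F\<^sub>j\<close>, a nonzero map
  between lines.\<close>

lemma raise_power:
  assumes m: "m \<le> d" and low: "\<And>l. l \<le> d \<Longrightarrow> m < l \<Longrightarrow> act (F l) w = 0"
    and top: "act (F m) w \<noteq> 0"
  shows "(\<forall>l\<le>d. m + k < l \<longrightarrow> act (F l) (act (T ^ k) w) = 0) \<and>
         (m + k \<le> d \<longrightarrow> act (F (m + k)) (act (T ^ k) w) \<noteq> 0)"
proof (induction k)
  case 0
  then show ?case using low top by (simp add: act_one)
next
  case (Suc k)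
  define u where "u = act (T ^ k) w"
  have step: "act (F l) (act (T ^ Suc k) w) = (\<Sum>j\<le>d. act (F l * T * F j) u)" for l
  proof -
    have "act (T ^ Suc k) w = act T (\<Sum>j\<le>d. act (F j) u)"
      by (simp add: act_mult u_def flip: idem_decomp)
    then show ?thesis by (simp add: act.sum act_mult)
  qed
  have IH0: "act (F l) u = 0" if "l \<le> d" "m + k < l" for l
    using Suc that by (simp add: u_def)
  have "act (F l) (act (T ^ Suc k) w) = 0" if l: "l \<le> d" "m + Suc k < l" for l
    unfolding step
  proof (rule sum.neutral, rule ballI)
    fix j assume "j \<in> {..d}"
    then show "act (F l * T * F j) u = 0"
      using raise_zero[of l j] l IH0[of j] by (cases "m + k < j") (simp_all add: act_mult)
  qed
  moreover have "act (F (m + Suc k)) (act (T ^ Suc k) w) \<noteq> 0" if mk: "m + Suc k \<le> d"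
  proof -
    define u' where "u' = act (F (m + k)) u"
    have u': "u' \<noteq> 0" "act (F (m + k)) u' = u'"
      using Suc mk by (simp_all add: u'_def u_def act_idem_idem)
    have "act (F (m + Suc k)) (act (T ^ Suc k) w) =
        (\<Sum>j\<le>d. if j = m + k then act (F (m + Suc k) * T * F (m + k)) u else 0)"
      unfolding step
    proof (rule sum.cong)
      fix j assume "j \<in> {..d}"
      then show "act (F (m + Suc k) * T * F j) u =
          (if j = m + k then act (F (m + Suc k) * T * F (m + k)) u else 0)"
        using raise_zero[of "m + Suc k" j] mk IH0[of j]
        by (cases "m + k < j"; cases "j = m + k") (simp_all add: act_mult)
    qed simp
    also have "\<dots> = act (F (m + Suc k) * T) u'"
      using mk by (simp add: act_mult u'_def)
    finally have eq: "act (F (m + Suc k)) (act (T ^ Suc k) w) = act (F (m + Suc k) * T) u'" .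
    obtain v where v: "act (F (m + Suc k) * T * F (m + k)) v \<noteq> 0"
      using faithful[of "F (m + Suc k) * T * F (m + k)"] raise_nonzero[of "m + k"] mk
      by (metis add_Suc_right)
    obtain c where "act (F (m + k)) v = smV c u'"
      using eigenspace_line[of "m + k" u' v] u' mk by auto
    then show ?thesis
      using v unfolding eq by (auto simp: act_mult act.scale)
  qed
  ultimately show ?case by blast
qed

text \<open>In a polynomial of degree \<open>k\<close> only the leading term reaches the component with index
  \<open>m + k\<close>. That this component is the same for all monic \<open>p\<close> is what makes it possible to
  exchange one polynomial for another.\<close>

lemma raise_aeval:
  assumes m: "m \<le> d" and low: "\<And>l. l \<le> d \<Longrightarrow> m < l \<Longrightarrow> act (F l) w = 0"
    and top: "act (F m) w \<noteq> 0"
    and deg: "degree p = k" and mon: "coeff p k = 1"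
  shows raise_aeval_above: "\<And>l. l \<le> d \<Longrightarrow> m + k < l \<Longrightarrow> act (F l) (act (aeval smA p T) w) = 0"
    and raise_aeval_top: "m + k \<le> d \<Longrightarrow>
      act (F (m + k)) (act (aeval smA p T) w) = act (F (m + k)) (act (T ^ k) w)"
    and raise_aeval_nonzero: "m + k \<le> d \<Longrightarrow> act (F (m + k)) (act (aeval smA p T) w) \<noteq> 0"
proof -
  note pow = raise_power[OF m low top]
  have expand: "act (F l) (act (aeval smA p T) w) =
      (\<Sum>i\<le>k. smV (coeff p i) (act (F l) (act (T ^ i) w)))" for l
    by (simp add: aeval_def deg act_sum_left act_smA act.sum act.scale)
  show "act (F l) (act (aeval smA p T) w) = 0" if "l \<le> d" "m + k < l" for l
    unfolding expand by (rule sum.neutral) (use pow that in auto)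
  show top_eq: "act (F (m + k)) (act (aeval smA p T) w) = act (F (m + k)) (act (T ^ k) w)"
    if mk: "m + k \<le> d"
  proof -
    have "act (F (m + k)) (act (aeval smA p T) w) =
        (\<Sum>i\<le>k. if i = k then act (F (m + k)) (act (T ^ k) w) else 0)"
      unfolding expand by (rule sum.cong) (use pow mk deg mon in auto)
    then show ?thesis by simp
  qed
  then show "m + k \<le> d \<Longrightarrow> act (F (m + k)) (act (aeval smA p T) w) \<noteq> 0"
    using pow by simp
qed

end


section \<open>Invariant bilinear forms\<close>

locale invariant_form = irreducible_module smA smV act
  for smA :: "'k::field \<Rightarrow> 'a::ring_1 \<Rightarrow> 'a"
    and smV :: "'k \<Rightarrow> 'v::ab_group_add \<Rightarrow> 'v"
    and act :: "'a \<Rightarrow> 'v \<Rightarrow> 'v" +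
  fixes dag :: "'a \<Rightarrow> 'a" and form :: "'v \<Rightarrow> 'v \<Rightarrow> 'k"
  assumes bilinear: "bilinear_form smV form"
    and form_nonzero: "\<exists>u v. form u v \<noteq> 0"
    and form_act: "form (act X u) v = form u (act (dag X) v)"
begin

sublocale form_right: Vector_Spaces.linear smV "(*)" "\<lambda>v. form u v" for u
  using bilinear by (simp add: bilinear_form_def)

sublocale form_left: Vector_Spaces.linear smV "(*)" "\<lambda>u. form u v" for v
  using bilinear by (simp add: bilinear_form_def)

text \<open>The radical of an invariant form is a submodule, and it is not the whole module.\<close>

lemma nondegenerate:
  assumes "\<And>v. form u v = 0"
  shows "u = 0"
proof -
  define W where "W = {u. \<forall>v. form u v = 0}"
  have "V.subspace W"
    by (rule V.subspaceI) (auto simp: W_def form_left.add form_left.scale)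
  then have "W = {0} \<or> W = UNIV"
    by (rule irreducible) (auto simp: W_def form_act)
  moreover have "W \<noteq> UNIV"
    using form_nonzero by (auto simp: W_def)
  ultimately show ?thesis
    using assms by (auto simp: W_def)
qed

end

locale selfadjoint_resolution =
    resolved_module smA d M smV act X \<theta> F + invariant_form smA smV act dag form
  for smA :: "'k::field \<Rightarrow> 'a::ring_1 \<Rightarrow> 'a" and d :: nat and M :: "'a \<Rightarrow> 'k mat"
    and smV :: "'k \<Rightarrow> 'v::ab_group_add \<Rightarrow> 'v" and act :: "'a \<Rightarrow> 'v \<Rightarrow> 'v"
    and X :: 'a and \<theta> :: "nat \<Rightarrow> 'k" and F :: "nat \<Rightarrow> 'a"
    and dag :: "'a \<Rightarrow> 'a" and form :: "'v \<Rightarrow> 'v \<Rightarrow> 'k" +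
  assumes dag_idem: "i \<le> d \<Longrightarrow> dag (F i) = F i"
begin

lemma form_idem: "i \<le> d \<Longrightarrow> form (act (F i) u) v = form u (act (F i) v)"
  by (simp add: form_act dag_idem)

text \<open>Different eigenspaces are orthogonal, so a vector of the line \<open>F i V\<close> that is
  orthogonal to itself is orthogonal to everything.\<close>

lemma form_self_nonzero:
  assumes "i \<le> d" "act (F i) u = u" "u \<noteq> 0"
  shows "form u u \<noteq> 0"
proof
  assume zero: "form u u = 0"
  have "form u v = 0" for v
  proof -
    obtain c where c: "act (F i) v = smV c u"
      using eigenspace_line[OF assms] by blast
    have "form u v = form u (act (F i) v)"
      using form_idem[OF assms(1), of u v] assms(2) by simp
    then show ?thesis
      using zero by (simp add: c form_right.scale)
  qed
  then show False
    using nondegenerate assms(3) by blast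
qed

lemma idem_projection:
  assumes "i \<le> d" "act (F i) u = u" "u \<noteq> 0"
  shows "act (F i) v = smV (form u v / form u u) u"
proof -
  obtain c where c: "act (F i) v = smV c u"
    using eigenspace_line[OF assms] by blast
  have "form u v = form u (act (F i) v)"
    using form_idem[OF assms(1), of u v] assms(2) by simp
  then have "form u v = c * form u u"
    by (simp add: c form_right.scale)
  then show ?thesis
    using form_self_nonzero[OF assms] by (simp add: c)
qed

lemma rescaled_projection:
  assumes u: "i \<le> d" "act (F i) u = u" "u \<noteq> 0" and v: "act (F i) v \<noteq> 0"
  shows "smV (form u u / form u v) (act (F i) v) = u"
proof -
  have "form u v \<noteq> 0"
    using v idem_projection[OF u, of v] by auto
  then show ?thesis
    using form_self_nonzero[OF u] by (simp add: idem_projection[OF u, of v])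
qed

end


section \<open>Leonard systems acting on the irreducible module\<close>

lemma monic_linear_product:
  fixes c :: "'b \<Rightarrow> 'k::field"
  assumes "card S = n"
  shows "degree (\<Prod>h\<in>S. [:- c h, 1:]) = n" "coeff (\<Prod>h\<in>S. [:- c h, 1:]) n = 1"
proof -
  show deg: "degree (\<Prod>h\<in>S. [:- c h, 1:]) = n"
    using assms by (simp add: degree_prod_eq_sum_degree)
  show "coeff (\<Prod>h\<in>S. [:- c h, 1:]) n = 1"
    using lead_coeff_prod[of "\<lambda>h. [:- c h, 1:]" S] by (simp add: deg)
qed

lemma monic_tau: "degree (tau \<theta> i) = i" "coeff (tau \<theta> i) i = 1"
  unfolding tau_def by (rule monic_linear_product; simp)+

lemma monic_eta: "degree (eta d \<theta> i) = i" "coeff (eta d \<theta> i) i = 1"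
  unfolding eta_def by (rule monic_linear_product; simp)+

lemma poly_tau_root: "j < i \<Longrightarrow> poly (tau \<theta> i) (\<theta> j) = 0"
  by (auto simp: tau_def poly_prod)

lemma poly_eta_root: "j \<le> d \<Longrightarrow> d < j + i \<Longrightarrow> poly (eta d \<theta> i) (\<theta> j) = 0"
  by (auto simp: eta_def poly_prod intro!: bexI[of _ "d - j"])

lemma poly_eta_nonroot:
  assumes "inj_on \<theta> {..d}" "j + i \<le> d"
  shows "poly (eta d \<theta> i) (\<theta> j) \<noteq> 0"
proof -
  have "\<theta> j \<noteq> \<theta> (d - h)" if "h < i" for h
    using inj_onD[OF assms(1), of j "d - h"] assms(2) that by auto
  then show ?thesis
    by (simp add: eta_def poly_prod)
qed

lemma poly_eta_full: "poly (eta d \<theta> d) (\<theta> 0) = (\<Prod>h=1..d. \<theta> 0 - \<theta> h)"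
  unfolding eta_def poly_prod
  by (rule prod.reindex_bij_witness[of _ "\<lambda>h. d - h" "\<lambda>h. d - h"]) auto

text \<open>The vector \<open>\<xi>s0\<close> is part of the setting because the nonvanishing of traces is tested
  on it.\<close>

locale leonard_module =
    E: hessenberg_operator smA d M smV act A \<theta> E As +
    Es: hessenberg_operator smA d M smV act As \<theta>s Es A +
    E: selfadjoint_resolution smA d M smV act A \<theta> E dag form +
    Es: selfadjoint_resolution smA d M smV act As \<theta>s Es dag form
  for smA :: "'k::field \<Rightarrow> 'a::ring_1 \<Rightarrow> 'a" and d :: nat and M :: "'a \<Rightarrow> 'k mat"
    and smV :: "'k \<Rightarrow> 'v::ab_group_add \<Rightarrow> 'v" and act :: "'a \<Rightarrow> 'v \<Rightarrow> 'v"
    and A As :: 'a and \<theta> \<theta>s :: "nat \<Rightarrow> 'k" and E Es :: "nat \<Rightarrow> 'a"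
    and dag :: "'a \<Rightarrow> 'a" and form :: "'v \<Rightarrow> 'v \<Rightarrow> 'k" +
  fixes \<xi>s0 :: 'v
  assumes \<xi>s0: "act (Es 0) \<xi>s0 = \<xi>s0" and \<xi>s0_nonzero: "\<xi>s0 \<noteq> 0"
begin

lemma \<xi>s0_start:
  shows "\<And>l. l \<le> d \<Longrightarrow> 0 < l \<Longrightarrow> act (Es l) \<xi>s0 = 0" and "act (Es 0) \<xi>s0 \<noteq> 0"
  using Es.act_other_idem[OF _ \<xi>s0] \<xi>s0 \<xi>s0_nonzero by auto

text \<open>If \<open>p\<close> has degree \<open>d\<close> and vanishes at all eigenvalues of \<open>A\<close> other than \<open>\<theta> r\<close>, then
  \<open>p(A) \<xi>*\<^sub>0\<close> is a multiple of \<open>E\<^sub>r \<xi>*\<^sub>0\<close>, while its \<open>E*\<^sub>d\<close>-component is nonzero.\<close>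

lemma component_nonzero:
  assumes r: "r \<le> d"
  shows "act (E r) \<xi>s0 \<noteq> 0"
proof
  assume zero: "act (E r) \<xi>s0 = 0"
  define p where "p = (\<Prod>j\<in>{..d} - {r}. [:- \<theta> j, 1:])"
  have p: "degree p = d" "coeff p d = 1"
    unfolding p_def by (rule monic_linear_product; use r in simp)+
  have "poly p (\<theta> j) = 0" if "j \<le> d" "j \<noteq> r" for j
    using that by (auto simp: p_def poly_prod)
  then have "act (aeval smA p A) \<xi>s0 = smV (poly p (\<theta> r)) (act (E r) \<xi>s0)"
    using r by (intro E.act_aeval_single) auto
  moreover have "act (Es (0 + d)) (act (aeval smA p A) \<xi>s0) \<noteq> 0"
    by (rule Es.raise_aeval_nonzero[OF _ \<xi>s0_start p]) simp_all
  ultimately show False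
    using zero by simp
qed

text \<open>The trace is the factor in \<open>E*\<^sub>0 E\<^sub>r \<xi>*\<^sub>0 = tr (E\<^sub>r E*\<^sub>0) \<xi>*\<^sub>0\<close>. Were it zero, then
  \<open>E\<^sub>r \<xi>*\<^sub>0\<close> would be orthogonal to \<open>\<xi>*\<^sub>0\<close>, hence to itself.\<close>

lemma trace_nonzero:
  assumes r: "r \<le> d"
  shows "tr M (E r * Es 0) \<noteq> 0"
proof
  assume "tr M (E r * Es 0) = 0"
  then have zero: "act (Es 0) (act (E r) \<xi>s0) = 0"
    using Es.act_sandwich[OF _ \<xi>s0, of "E r"] by simp
  have "form (act (E r) \<xi>s0) (act (E r) \<xi>s0) = form \<xi>s0 (act (E r) \<xi>s0)"
    using r by (simp add: E.form_idem E.act_idem_idem)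
  also have "\<dots> = form \<xi>s0 (act (Es 0) (act (E r) \<xi>s0))"
    using Es.form_idem[of 0 \<xi>s0] \<xi>s0 by simp
  also have "\<dots> = 0"
    by (simp add: zero)
  finally show False
    using E.form_self_nonzero[OF r _ component_nonzero[OF r]] r by (simp add: E.act_idem_idem)
qed

text \<open>The vector \<open>w = \<eta>\<^sub>i(A) \<xi>*\<^sub>0\<close> has \<open>E*\<close>-components with indices up to \<open>i\<close> only and
  \<open>E\<close>-components with indices up to \<open>d - i\<close> only. Were its \<open>E*\<^sub>0\<close>-component zero, then the
  polynomial \<open>q\<close> with roots \<open>\<theta>s 1\<close> to \<open>\<theta>s i\<close> would give \<open>q(A*) w = 0\<close>. But \<open>q(A*)\<close>
  raises the top \<open>E\<close>-component of \<open>w\<close> to a nonzero one with index \<open>d\<close>.\<close>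

lemma trace_eta_nonzero:
  assumes i: "i \<le> d"
  shows "tr M (aeval smA (eta d \<theta> i) A * Es 0) \<noteq> 0"
proof
  assume tr0: "tr M (aeval smA (eta d \<theta> i) A * Es 0) = 0"
  define w where "w = act (aeval smA (eta d \<theta> i) A) \<xi>s0"
  have w0: "act (Es 0) w = 0"
    using Es.act_sandwich[OF _ \<xi>s0] tr0 by (simp add: w_def)
  have w_high: "act (Es l) w = 0" if "l \<le> d" "i < l" for l
    using Es.raise_aeval_above[OF _ \<xi>s0_start monic_eta, of l] that by (simp add: w_def)
  have E_high: "act (E l) w = 0" if "l \<le> d" "d - i < l" for l
    using that by (simp add: w_def E.act_idem_aeval poly_eta_root)
  have E_top: "act (E (d - i)) w \<noteq> 0"
    using component_nonzero[of "d - i"] poly_eta_nonroot[OF E.eigenvalue_inj, of "d - i" i] i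
    by (simp add: w_def E.act_idem_aeval)
  define q where "q = (\<Prod>j\<in>{1..i}. [:- \<theta>s j, 1:])"
  have q: "degree q = i" "coeff q i = 1"
    unfolding q_def by (rule monic_linear_product; simp)+
  have "act (aeval smA q As) w = 0"
    unfolding Es.act_aeval
  proof (rule sum.neutral, rule ballI)
    fix j assume j: "j \<in> {..d}"
    show "smV (poly q (\<theta>s j)) (act (Es j) w) = 0"
    proof (cases "1 \<le> j \<and> j \<le> i")
      case True
      then have "poly q (\<theta>s j) = 0"
        by (auto simp: q_def poly_prod)
      then show ?thesis by simp
    next
      case False
      then show ?thesis
        using w0 w_high[of j] j by (cases "j = 0") auto
    qed
  qed
  moreover have "act (E (d - i + i)) (act (aeval smA q As) w) \<noteq> 0"
    by (rule E.raise_aeval_nonzero[OF _ E_high E_top q]) (use i in simp_all)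
  ultimately show False by simp
qed

text \<open>The traces telescope, starting from \<open>tr (E*\<^sub>0) = 1\<close>.\<close>

lemma prod_phi:
  assumes phi: "\<And>i. 1 \<le> i \<Longrightarrow> i \<le> d \<Longrightarrow> phi i = (\<theta>s 0 - \<theta>s i) *
        (tr M (aeval smA (eta d \<theta> i) A * Es 0) / tr M (aeval smA (eta d \<theta> (i - 1)) A * Es 0))"
  shows "(\<Prod>h=1..d. phi h) =
    poly (eta d \<theta>s d) (\<theta>s 0) * tr M (aeval smA (eta d \<theta> d) A * Es 0)"
proof -
  define t where "t i = tr M (aeval smA (eta d \<theta> i) A * Es 0)" for i
  have "smV (t 0) \<xi>s0 = act (Es 0) (act (aeval smA (eta d \<theta> 0) A) \<xi>s0)"
    using Es.act_sandwich[OF _ \<xi>s0] by (simp add: t_def)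
  also have "act (aeval smA (eta d \<theta> 0) A) \<xi>s0 = \<xi>s0"
    using E.idem_decomp[of \<xi>s0] by (simp add: E.act_aeval eta_def)
  also have "act (Es 0) \<xi>s0 = smV 1 \<xi>s0"
    by (simp add: \<xi>s0)
  finally have t0: "t 0 = 1"
    using \<xi>s0_nonzero by (simp only: E.V.scale_right_imp_eq)
  have "(\<Prod>h=1..n. phi h) = (\<Prod>h=1..n. \<theta>s 0 - \<theta>s h) * t n" if "n \<le> d" for n
    using that
  proof (induction n)
    case 0
    then show ?case by (simp add: t0)
  next
    case (Suc n)
    then have "phi (Suc n) = (\<theta>s 0 - \<theta>s (Suc n)) * (t (Suc n) / t n)"
      using phi[of "Suc n"] by (simp add: t_def)
    moreover have "t n \<noteq> 0"
      using trace_eta_nonzero[of n] Suc.prems by (simp add: t_def)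
    ultimately show ?case
      using Suc by simp
  qed
  then show ?thesis
    by (simp add: poly_eta_full t_def)
qed

text \<open>The polynomial \<open>\<tau>\<^sub>i \<eta>\<^bsub>d-i\<^esub>\<close> is monic of degree \<open>d\<close> and vanishes at all eigenvalues
  but \<open>\<theta> i\<close>, so its value at \<open>A\<close> is a multiple of \<open>E\<^sub>i\<close>. For the \<open>E*\<^sub>d\<close>-component it may be
  replaced by \<open>\<eta>\<^sub>d\<close>, whatever \<open>i\<close> is.\<close>

lemma last_component:
  assumes i: "i \<le> d"
  shows "smV (poly (tau \<theta> i) (\<theta> i) * poly (eta d \<theta> (d - i)) (\<theta> i)) (act (Es d) (act (E i) \<xi>s0)) =
    act (Es d) (act (aeval smA (eta d \<theta> d) A) \<xi>s0)"
proof -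
  define p where "p = tau \<theta> i * eta d \<theta> (d - i)"
  have nz: "tau \<theta> i \<noteq> 0" "eta d \<theta> (d - i) \<noteq> 0"
    using monic_tau(2)[of \<theta> i] monic_eta(2)[of d \<theta> "d - i"] by auto
  have p: "degree p = d" "coeff p d = 1"
    using i nz coeff_mult_degree_sum[of "tau \<theta> i" "eta d \<theta> (d - i)"]
    by (simp_all add: p_def degree_mult_eq monic_tau monic_eta)
  have "poly p (\<theta> j) = 0" if "j \<le> d" "j \<noteq> i" for j
    using that i poly_tau_root[of j i \<theta>] poly_eta_root[of j d "d - i" \<theta>]
    by (cases "j < i") (auto simp: p_def)
  then have "act (aeval smA p A) \<xi>s0 = smV (poly p (\<theta> i)) (act (E i) \<xi>s0)"
    using i by (intro E.act_aeval_single) auto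
  then have "smV (poly p (\<theta> i)) (act (Es d) (act (E i) \<xi>s0)) =
      act (Es (0 + d)) (act (aeval smA p A) \<xi>s0)"
    by (simp add: E.act.scale)
  also have "\<dots> = act (Es (0 + d)) (act (A ^ d) \<xi>s0)"
    by (rule Es.raise_aeval_top[OF _ \<xi>s0_start p]) simp_all
  also have "\<dots> = act (Es (0 + d)) (act (aeval smA (eta d \<theta> d) A) \<xi>s0)"
    by (rule Es.raise_aeval_top[OF _ \<xi>s0_start monic_eta, symmetric]) simp_all
  finally show ?thesis by (simp add: p_def)
qed

text \<open>As \<open>y = \<eta>\<^sub>d(A) \<xi>*\<^sub>0\<close> lies in \<open>E\<^sub>0 V\<close>, the vectors \<open>E\<^sub>d \<tau>*\<^sub>d(A*) y\<close> and \<open>E\<^sub>d \<eta>*\<^sub>d(A*) y\<close>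
  agree. The operators \<open>\<tau>*\<^sub>d(A*)\<close> and \<open>\<eta>*\<^sub>d(A*)\<close> are multiples of \<open>E*\<^sub>d\<close> and \<open>E*\<^sub>0\<close>.\<close>

lemma last_component_projection:
  "smV (poly (tau \<theta>s d) (\<theta>s d)) (act (E d) (act (Es d) (act (aeval smA (eta d \<theta> d) A) \<xi>s0))) =
   smV (poly (eta d \<theta>s d) (\<theta>s 0) * tr M (aeval smA (eta d \<theta> d) A * Es 0)) (act (E d) \<xi>s0)"
proof -
  define y where "y = act (aeval smA (eta d \<theta> d) A) \<xi>s0"
  have y_high: "act (E l) y = 0" if "l \<le> d" "0 < l" for l
    using that by (simp add: y_def E.act_idem_aeval poly_eta_root)
  have y_bot: "act (E 0) y \<noteq> 0"
    using component_nonzero[of 0] poly_eta_nonroot[OF E.eigenvalue_inj, of 0 d]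
    by (simp add: y_def E.act_idem_aeval)
  have "act (aeval smA (tau \<theta>s d) As) y = smV (poly (tau \<theta>s d) (\<theta>s d)) (act (Es d) y)"
    by (rule Es.act_aeval_single) (simp_all add: poly_tau_root)
  then have "smV (poly (tau \<theta>s d) (\<theta>s d)) (act (E d) (act (Es d) y)) =
      act (E (0 + d)) (act (aeval smA (tau \<theta>s d) As) y)"
    by (simp add: E.act.scale)
  also have "\<dots> = act (E (0 + d)) (act (As ^ d) y)"
    by (rule E.raise_aeval_top[OF _ y_high y_bot monic_tau]) simp_all
  also have "\<dots> = act (E (0 + d)) (act (aeval smA (eta d \<theta>s d) As) y)"
    by (rule E.raise_aeval_top[OF _ y_high y_bot monic_eta, symmetric]) simp_all
  also have "act (aeval smA (eta d \<theta>s d) As) y = smV (poly (eta d \<theta>s d) (\<theta>s 0)) (act (Es 0) y)"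
    by (rule Es.act_aeval_single) (simp_all add: poly_eta_root)
  also have "act (Es 0) y = smV (tr M (aeval smA (eta d \<theta> d) A * Es 0)) \<xi>s0"
    using Es.act_sandwich[OF _ \<xi>s0] by (simp add: y_def)
  finally show ?thesis
    by (simp add: E.act.scale y_def)
qed

lemma transition_first:
  assumes "i \<le> d"
  shows "act (\<Sum>r\<le>d. smA (1 / tr M (E r * Es 0)) (Z r * Es 0 * E r)) (act (E i) \<xi>s0) = act (Z i) \<xi>s0"
  unfolding E.sum_mult_idem_act[OF assms]
  using Es.act_sandwich[OF _ \<xi>s0, of "E i"] trace_nonzero[OF assms]
  by (simp add: E.act_mult E.act.scale)

text \<open>Write \<open>K = \<kappa> \<xi>*\<^sub>d\<close>. Both \<open>E\<^sub>d K\<close> and \<open>E\<^sub>d \<xi>*\<^sub>0\<close> are known multiples of \<open>\<xi>\<^sub>d\<close>, and comparing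
  them determines \<open>\<kappa>\<close>.\<close>

lemma transition_last:
  assumes phi: "\<And>i. 1 \<le> i \<Longrightarrow> i \<le> d \<Longrightarrow> phi i = (\<theta>s 0 - \<theta>s i) *
        (tr M (aeval smA (eta d \<theta> i) A * Es 0) / tr M (aeval smA (eta d \<theta> (i - 1)) A * Es 0))"
    and \<xi>d: "act (E d) \<xi>d = \<xi>d" "\<xi>d \<noteq> 0" and \<xi>sd: "act (Es d) \<xi>sd = \<xi>sd" "\<xi>sd \<noteq> 0"
    and i: "i \<le> d"
  shows "act (smA (poly (tau \<theta>s d) (\<theta>s d) / (\<Prod>h=1..d. phi h) * (form \<xi>d \<xi>sd / form \<xi>d \<xi>s0))
      (\<Sum>r\<le>d. smA (poly (tau \<theta> r) (\<theta> r) * poly (eta d \<theta> (d - r)) (\<theta> r)) (Z r * Es d * E r)))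
      (act (E i) \<xi>s0) = act (Z i) \<xi>sd"
proof -
  define K where "K = act (Es d) (act (aeval smA (eta d \<theta> d) A) \<xi>s0)"
  define \<Phi> where "\<Phi> = (\<Prod>h=1..d. phi h)"
  define \<tau> where "\<tau> = poly (tau \<theta>s d) (\<theta>s d)"
  have \<Phi>_eq: "\<Phi> = poly (eta d \<theta>s d) (\<theta>s 0) * tr M (aeval smA (eta d \<theta> d) A * Es 0)"
    unfolding \<Phi>_def by (rule prod_phi) (rule phi)
  have \<Phi>_nz: "\<Phi> \<noteq> 0"
    using trace_eta_nonzero[of d] poly_eta_nonroot[OF Es.eigenvalue_inj, of 0 d] by (simp add: \<Phi>_eq)
  obtain \<kappa> where \<kappa>: "K = smV \<kappa> \<xi>sd"
    using Es.eigenspace_line[OF _ \<xi>sd] unfolding K_def by blast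
  have norm: "form \<xi>d \<xi>d \<noteq> 0"
    by (rule E.form_self_nonzero[OF _ \<xi>d]) simp
  have proj: "act (E d) v = smV (form \<xi>d v / form \<xi>d \<xi>d) \<xi>d" for v
    by (rule E.idem_projection[OF _ \<xi>d]) simp
  have b: "form \<xi>d \<xi>s0 \<noteq> 0"
    using component_nonzero[of d] proj[of \<xi>s0] by auto
  have "smV \<tau> (act (E d) K) = smV \<Phi> (act (E d) \<xi>s0)"
    using last_component_projection by (simp add: K_def \<tau>_def \<Phi>_eq)
  then have "smV (\<tau> * \<kappa> * form \<xi>d \<xi>sd / form \<xi>d \<xi>d) \<xi>d = smV (\<Phi> * form \<xi>d \<xi>s0 / form \<xi>d \<xi>d) \<xi>d"
    unfolding \<kappa> E.act.scale proj E.V.scale_scale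
    by (simp only: times_divide_eq_right mult.assoc)
  then have "\<tau> * \<kappa> * form \<xi>d \<xi>sd = \<Phi> * form \<xi>d \<xi>s0"
    using \<xi>d(2) norm by simp
  moreover have "\<tau> / \<Phi> * (form \<xi>d \<xi>sd / form \<xi>d \<xi>s0) * \<kappa> =
      \<tau> * \<kappa> * form \<xi>d \<xi>sd / (\<Phi> * form \<xi>d \<xi>s0)"
    by simp
  ultimately have coeff: "\<tau> / \<Phi> * (form \<xi>d \<xi>sd / form \<xi>d \<xi>s0) * \<kappa> = 1"
    using \<Phi>_nz b by simp
  have "act (\<Sum>r\<le>d. smA (poly (tau \<theta> r) (\<theta> r) * poly (eta d \<theta> (d - r)) (\<theta> r)) (Z r * Es d * E r))
      (act (E i) \<xi>s0) = act (Z i) K"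
    unfolding E.sum_mult_idem_act[OF i] K_def last_component[OF i, symmetric]
    by (simp add: E.act_mult E.act.scale)
  then show ?thesis
    unfolding \<Phi>_def[symmetric] \<tau>_def[symmetric]
    by (simp only: E.act_smA \<kappa> E.act.scale E.V.scale_scale coeff E.V.scale_one)
qed

lemma transition_dual:
  assumes "n \<le> d" "act (E n) \<xi> = \<xi>" "\<xi> \<noteq> 0" and i: "i \<le> d"
  shows "act (smA (form \<xi> \<xi> / form \<xi> \<xi>s0)
      (\<Sum>r\<le>d. smA (1 / tr M (E r * Es 0)) (Z r * E n * Es 0 * E r))) (act (E i) \<xi>s0) = act (Z i) \<xi>"
proof -
  have "act (\<Sum>r\<le>d. smA (1 / tr M (E r * Es 0)) (Z r * E n * Es 0 * E r)) (act (E i) \<xi>s0) =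
      act (Z i) (act (E n) \<xi>s0)"
    using transition_first[OF i, of "\<lambda>r. Z r * E n"] by (simp add: E.act_mult)
  then show ?thesis
    using E.rescaled_projection[OF assms(1-3) component_nonzero[OF assms(1)]]
    by (simp add: E.act_smA flip: E.act.scale)
qed

end

lemma (in full_matrix_algebra) leonard_module_intro:
  assumes module: "irreducible_module smA smV act"
    and ls: "leonard_system smA d M A E As Es"
    and pa: "parameter_array smA d M A E As Es \<theta> \<theta>s varphi phi"
    and dag: "antiautomorphism smA dag" "dag A = A" "dag As = As"
    and form: "bilinear_form smV form" "\<exists>u v. form u v \<noteq> 0"
      "\<And>X u v. form (act X u) v = form u (act (dag X) v)"
    and \<xi>s0: "\<xi>s0 \<in> range (act (Es 0))" "\<xi>s0 \<noteq> 0"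
  shows "leonard_module smA d M smV act A As \<theta> \<theta>s E Es dag form \<xi>s0"
proof -
  interpret irreducible_module smA smV act by fact
  interpret matrix_module smA d M smV act by unfold_locales
  interpret invariant_form smA smV act dag form
    by unfold_locales (use form in auto)
  have "inj_on E {0..d}" "inj_on Es {0..d}"
    using ls by (auto simp: leonard_system_def bij_betw_def)
  then have inj: "inj_on \<theta> {..d}" "inj_on \<theta>s {..d}"
    using pa by (auto simp: parameter_array_def inj_on_def)
  interpret E: primitive_resolution smA d M A \<theta> E
    using ls pa inj by (intro primitive_resolution_of_multiplicity_free)
      (auto simp: leonard_system_def parameter_array_def)
  interpret Es: primitive_resolution smA d M As \<theta>s Es
    using ls pa inj by (intro primitive_resolution_of_multiplicity_free)
      (auto simp: leonard_system_def parameter_array_def)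
  have tri_zero: "E l * As * E j = 0" "Es l * A * Es j = 0"
    if "l \<le> d" "j \<le> d" "\<bar>int l - int j\<bar> > 1" for l j
    using ls that unfolding leonard_system_def by blast+
  have tri_nonzero: "E l * As * E j \<noteq> 0" "Es l * A * Es j \<noteq> 0"
    if "l \<le> d" "j \<le> d" "\<bar>int l - int j\<bar> = 1" for l j
    using ls that unfolding leonard_system_def by blast+
  interpret E: resolved_module smA d M smV act A \<theta> E by unfold_locales
  interpret Es: resolved_module smA d M smV act As \<theta>s Es by unfold_locales
  show ?thesis
  proof unfold_locales
    fix i assume "i \<le> d"
    then show "dag (E i) = E i" "dag (Es i) = Es i"
      using pa dag by (simp_all add: parameter_array_def primitive_idempotent_def antiautomorphism_aeval)
  next
    fix l j assume "l \<le> d" "Suc j < l"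
    then show "E l * As * E j = 0" "Es l * A * Es j = 0"
      by (simp_all add: tri_zero)
  next
    fix j assume "Suc j \<le> d"
    then show "E (Suc j) * As * E j \<noteq> 0" "Es (Suc j) * A * Es j \<noteq> 0"
      by (simp_all add: tri_nonzero)
  next
    show "act (Es 0) \<xi>s0 = \<xi>s0" by (rule Es.range_idem[OF _ \<xi>s0(1)]) simp
    show "\<xi>s0 \<noteq> 0" by fact
  qed
qed

theorem theorem10p2:
  fixes d :: nat
    and smA :: "'k::field \<Rightarrow> 'a::ring_1 \<Rightarrow> 'a" (infixr "*\<^sub>A" 75)
    and smV :: "'k \<Rightarrow> 'v::ab_group_add \<Rightarrow> 'v"
    and M :: "'a \<Rightarrow> 'k mat"
    and act :: "'a \<Rightarrow> 'v \<Rightarrow> 'v" (infixr "\<rhd>" 70)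
    and A As :: 'a and E Es :: "nat \<Rightarrow> 'a"
    and \<theta> \<theta>s varphi phi :: "nat \<Rightarrow> 'k"
    and dag :: "'a \<Rightarrow> 'a"
    and form :: "'v \<Rightarrow> 'v \<Rightarrow> 'k" ("\<langle>_, _\<rangle>")
    and \<xi>0 \<xi>d \<xi>s0 \<xi>sd :: 'v
  assumes "full_matrix_algebra smA d M"
    and "irreducible_module smA smV act"
    and "leonard_system smA d M A E As Es"
    and "parameter_array smA d M A E As Es \<theta> \<theta>s varphi phi"
    and "antiautomorphism smA dag" and "dag A = A" and "dag As = As"
    and "bilinear_form smV form" and "\<exists>u v. \<langle>u, v\<rangle> \<noteq> 0"
    and "\<And>X u v. \<langle>X \<rhd> u, v\<rangle> = \<langle>u, dag X \<rhd> v\<rangle>"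
    and "\<xi>0 \<in> range (act (E 0))" and "\<xi>0 \<noteq> 0"
    and "\<xi>d \<in> range (act (E d))" and "\<xi>d \<noteq> 0"
    and "\<xi>s0 \<in> range (act (Es 0))" and "\<xi>s0 \<noteq> 0"
    and "\<xi>sd \<in> range (act (Es d))" and "\<xi>sd \<noteq> 0"
  shows
    "(\<forall>X \<in> {E, \<lambda>i. E (d - i),
            \<lambda>i. aeval smA (tau \<theta> i) A, \<lambda>i. aeval smA (tau \<theta> (d - i)) A,
            \<lambda>i. aeval smA (eta d \<theta> i) A, \<lambda>i. aeval smA (eta d \<theta> (d - i)) A}. \<forall>i\<le>d.
       (\<Sum>r\<le>d. (1 / tr M (E r * Es 0)) *\<^sub>A (X r * Es 0 * E r)) \<rhd> E i \<rhd> \<xi>s0 = X i \<rhd> \<xi>s0 \<and>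
       ((poly (tau \<theta>s d) (\<theta>s d) / (\<Prod>h=1..d. phi h) * (\<langle>\<xi>d, \<xi>sd\<rangle> / \<langle>\<xi>d, \<xi>s0\<rangle>)) *\<^sub>A
         (\<Sum>r\<le>d. (poly (tau \<theta> r) (\<theta> r) * poly (eta d \<theta> (d - r)) (\<theta> r)) *\<^sub>A (X r * Es d * E r)))
         \<rhd> E i \<rhd> \<xi>s0 = X i \<rhd> \<xi>sd \<and>
       (\<Sum>r\<le>d. (1 / tr M (E r * Es 0)) *\<^sub>A (X (d - r) * Es 0 * E r)) \<rhd> E (d - i) \<rhd> \<xi>s0 = X i \<rhd> \<xi>s0 \<and>
       ((poly (tau \<theta>s d) (\<theta>s d) / (\<Prod>h=1..d. phi h) * (\<langle>\<xi>d, \<xi>sd\<rangle> / \<langle>\<xi>d, \<xi>s0\<rangle>)) *\<^sub>A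
         (\<Sum>r\<le>d. (poly (tau \<theta> r) (\<theta> r) * poly (eta d \<theta> (d - r)) (\<theta> r)) *\<^sub>A (X (d - r) * Es d * E r)))
         \<rhd> E (d - i) \<rhd> \<xi>s0 = X i \<rhd> \<xi>sd) \<and>
     (\<forall>X \<in> {Es, \<lambda>i. Es (d - i),
            \<lambda>i. aeval smA (tau \<theta>s i) As, \<lambda>i. aeval smA (tau \<theta>s (d - i)) As,
            \<lambda>i. aeval smA (eta d \<theta>s i) As, \<lambda>i. aeval smA (eta d \<theta>s (d - i)) As}. \<forall>i\<le>d.
       ((\<langle>\<xi>0, \<xi>0\<rangle> / \<langle>\<xi>0, \<xi>s0\<rangle>) *\<^sub>A
         (\<Sum>r\<le>d. (1 / tr M (E r * Es 0)) *\<^sub>A (X r * E 0 * Es 0 * E r))) \<rhd> E i \<rhd> \<xi>s0 = X i \<rhd> \<xi>0 \<and>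
       ((\<langle>\<xi>d, \<xi>d\<rangle> / \<langle>\<xi>d, \<xi>s0\<rangle>) *\<^sub>A
         (\<Sum>r\<le>d. (1 / tr M (E r * Es 0)) *\<^sub>A (X r * E d * Es 0 * E r))) \<rhd> E i \<rhd> \<xi>s0 = X i \<rhd> \<xi>d \<and>
       ((\<langle>\<xi>0, \<xi>0\<rangle> / \<langle>\<xi>0, \<xi>s0\<rangle>) *\<^sub>A
         (\<Sum>r\<le>d. (1 / tr M (E r * Es 0)) *\<^sub>A (X (d - r) * E 0 * Es 0 * E r))) \<rhd> E (d - i) \<rhd> \<xi>s0 = X i \<rhd> \<xi>0 \<and>
       ((\<langle>\<xi>d, \<xi>d\<rangle> / \<langle>\<xi>d, \<xi>s0\<rangle>) *\<^sub>A
         (\<Sum>r\<le>d. (1 / tr M (E r * Es 0)) *\<^sub>A (X (d - r) * E d * Es 0 * E r))) \<rhd> E (d - i) \<rhd> \<xi>s0 = X i \<rhd> \<xi>d)"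
proof -
  interpret leonard_module smA d M smV act A As \<theta> \<theta>s E Es dag form \<xi>s0
    by (rule full_matrix_algebra.leonard_module_intro) (fact assms)+
  have \<xi>0: "act (E 0) \<xi>0 = \<xi>0" and \<xi>d: "act (E d) \<xi>d = \<xi>d" and \<xi>sd: "act (Es d) \<xi>sd = \<xi>sd"
    using E.range_idem[OF _ assms(11)] E.range_idem[OF _ assms(13)] Es.range_idem[OF _ assms(17)]
    by blast+
  have phi: "phi i = (\<theta>s 0 - \<theta>s i) *
      (tr M (aeval smA (eta d \<theta> i) A * Es 0) / tr M (aeval smA (eta d \<theta> (i - 1)) A * Es 0))"
    if "1 \<le> i" "i \<le> d" for i
    using assms(4) that by (simp add: parameter_array_def)
  note last = transition_last[of phi, OF phi \<xi>d assms(14) \<xi>sd assms(18)]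
  note dual0 = transition_dual[OF _ \<xi>0 assms(12)] and duald = transition_dual[OF _ \<xi>d assms(14)]
  show ?thesis
  proof (intro conjI ballI allI impI, goal_cases)
    case (1 X i) then show ?case using transition_first by simp
  next
    case (2 X i) then show ?case using last by simp
  next
    case (3 X i) then show ?case using transition_first[of "d - i" "\<lambda>r. X (d - r)"] by simp
  next
    case (4 X i) then show ?case using last[of "d - i" "\<lambda>r. X (d - r)"] by simp
  next
    case (5 X i) then show ?case using dual0 by simp
  next
    case (6 X i) then show ?case using duald by simp
  next
    case (7 X i) then show ?case using dual0[of "d - i" "\<lambda>r. X (d - r)"] by simp
  next
    case (8 X i) then show ?case using duald[of "d - i" "\<lambda>r. X (d - r)"] by simp
  qed
qed

end
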